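(* Let $T$ be the set of natural numbers $n$ whose $\varphi$-representation has exactly one even exponent. Then the set of Zeckendorf representations of the elements of $T$ is accepted by a deterministic finite automaton (i.e. is a regular language). Furthermore, a natural number $n \ge 1$ lies in $T$ if and only if $n-1$ is a (possibly empty) sum of distinct odd-indexed Lucas numbers $L_{2i+1}$ with $i \ge 0$.
   Context: $\varphi = (1+\sqrt{5})/2$. Every real $x \ge 0$ has a unique $\varphi$-representation $x = \sum_{i \le t} e_i \varphi^i$ with $e_i \in \{0,1\}$, $e_i e_{i+1} = 0$ for all $i$, and no infinite tail $1010\cdots$; for natural numbers it is finite. The exponents of the representation are the $i$ with $e_i = 1$. Lucas numbers: $L_0 = 2$, $L_1 = 1$, $L_k = L_{k-1} + L_{k-2}$. The Zeckendorf representation of $n$ is the unique binary string $b_t \cdots b_2$ (no leading zero, no two adjacent $1$s) with $n = \sum_{i=2}^t b_i F_i$, where $F_i$ are the Fibonacci numbers ($F_0=0,F_1=1$). *)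

theory Defs
  imports "HOL-Analysis.Analysis" "HOL-Number_Theory.Fib"
begin

definition golden :: real where
  "golden = (1 + sqrt 5) / 2"

text \<open>The digit string \<open>e\<close> is read from high to low exponents, so the excluded tail
  \<open>1010\<dots>\<close> starting at exponent \<open>N\<close> has ones at \<open>N, N - 2, N - 4, \<dots>\<close>.\<close>

definition is_phi_rep :: "(int \<Rightarrow> nat) \<Rightarrow> real \<Rightarrow> bool" where
  "is_phi_rep e x \<longleftrightarrow>
     (\<forall>i. e i \<in> {0, 1}) \<and>
     (\<forall>i. e i * e (i + 1) = 0) \<and>
     \<not> (\<exists>N. \<forall>k::nat. e (N - 2 * int k) = 1 \<and> e (N - 2 * int k - 1) = 0) \<and>
     (\<exists>t. (\<forall>i>t. e i = 0) \<and> ((\<lambda>i. real (e i) * golden powi i) has_sum x) {..t})"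

definition phi_rep :: "real \<Rightarrow> int \<Rightarrow> nat" where
  "phi_rep x = (THE e. is_phi_rep e x)"

definition phi_exponents :: "real \<Rightarrow> int set" where
  "phi_exponents x = {i. phi_rep x i = 1}"

definition one_even_exponent :: "nat set" where
  "one_even_exponent = {n. card {i \<in> phi_exponents (real n). even i} = 1}"

fun lucas :: "nat \<Rightarrow> nat" where
  "lucas 0 = 2"
| "lucas (Suc 0) = 1"
| "lucas (Suc (Suc k)) = lucas (Suc k) + lucas k"

text \<open>The list \<open>w = [b\<^sub>t, \<dots>, b\<^sub>2]\<close> has length \<open>t - 1\<close>, so \<open>w ! j\<close> is the digit of
  the Fibonacci number with index \<open>t - j = length w + 1 - j\<close>. The representation of \<open>0\<close> is
  the empty string.\<close>

definition is_zeckendorf :: "nat list \<Rightarrow> nat \<Rightarrow> bool" where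
  "is_zeckendorf w n \<longleftrightarrow>
     set w \<subseteq> {0, 1} \<and>
     (w \<noteq> [] \<longrightarrow> hd w \<noteq> 0) \<and>
     (\<forall>j. Suc j < length w \<longrightarrow> \<not> (w ! j = 1 \<and> w ! Suc j = 1)) \<and>
     n = (\<Sum>j<length w. w ! j * fib (length w + 1 - j))"

definition zeckendorf :: "nat \<Rightarrow> nat list" where
  "zeckendorf n = (THE w. is_zeckendorf w n)"

record ('q, 'a) dfa =
  states :: "'q set"
  init :: 'q
  final :: "'q set"
  nxt :: "'q \<Rightarrow> 'a \<Rightarrow> 'q"

definition is_dfa :: "'a set \<Rightarrow> ('q, 'a) dfa \<Rightarrow> bool" where
  "is_dfa \<Sigma> M \<longleftrightarrow>
     finite (states M) \<and> init M \<in> states M \<and> final M \<subseteq> states M \<and>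
     (\<forall>q\<in>states M. \<forall>a\<in>\<Sigma>. nxt M q a \<in> states M)"

definition dfa_language :: "'a set \<Rightarrow> ('q, 'a) dfa \<Rightarrow> 'a list set" where
  "dfa_language \<Sigma> M = {w \<in> lists \<Sigma>. foldl (nxt M) (init M) w \<in> final M}"

text \<open>States of type \<^typ>\<open>nat\<close> lose no generality, since state sets are finite.\<close>

definition regular_language :: "'a set \<Rightarrow> 'a list set \<Rightarrow> bool" where
  "regular_language \<Sigma> L \<longleftrightarrow> (\<exists>M :: (nat, 'a) dfa. is_dfa \<Sigma> M \<and> dfa_language \<Sigma> M = L)"

end

theory Submission
  imports Defs
begin

text \<open>
  Write \<open>L\<^sub>2\<^sub>i\<^sub>+\<^sub>1 = \<phi>\<^sup>2\<^sup>i\<^sup>+\<^sup>1 - \<phi>\<^sup>-\<^sup>(\<^sup>2\<^sup>i\<^sup>+\<^sup>1\<^sup>)\<close>. Since \<open>1\<close> equals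
  \<open>\<phi>\<^sup>-\<^sup>1 + \<phi>\<^sup>-\<^sup>3 + \<dots> + \<phi>\<^sup>-\<^sup>(\<^sup>2\<^sup>m\<^sup>-\<^sup>1\<^sup>) + \<phi>\<^sup>-\<^sup>2\<^sup>m\<close>, adding \<open>1\<close> to a sum of odd-indexed Lucas
  numbers with largest index \<open>2 m - 1\<close> cancels all negative terms and leaves a valid representation
  whose only even exponent is \<open>- 2 m\<close>. Conversely, let \<open>k\<close> be the only even exponent of \<open>n \<ge> 1\<close>.
  Applying the conjugation \<open>\<phi> \<mapsto> 1 - \<phi>\<close> gives \<open>n \<le> \<phi>\<^sup>-\<^sup>k\<close>, so \<open>k \<le> 0\<close>; subtracting from \<open>n\<close> the Lucas
  numbers indexed by the positive exponents leaves an integer strictly between \<open>0\<close> and \<open>2\<close>.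

  For regularity, read a Zeckendorf representation from the left and guess the Lucas numbers in
  parallel. The difference between what was read and what was guessed has the form
  \<open>a F\<^sub>R\<^sub>+\<^sub>1 + b F\<^sub>R\<close>, where \<open>R\<close> is the number of remaining digits, and only finitely many pairs
  \<open>(a, b)\<close> can still be completed.
\<close>

section \<open>Existence and uniqueness of golden ratio representations\<close>

lemma golden_gt_1: "golden > 1"
  unfolding golden_def by (simp add: real_less_rsqrt)

lemma golden_sq: "golden\<^sup>2 = golden + 1"
  unfolding golden_def by (simp add: power2_eq_square field_simps)

lemma golden_powi_pos [simp]: "golden powi i > 0"
  using golden_gt_1 by simp

lemma golden_powi_step: "golden powi (i + 2) = golden powi (i + 1) + golden powi i"
  using golden_gt_1 golden_sq by (simp add: power_int_add power2_eq_square algebra_simps)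

lemma golden_powi_Suc: "golden powi (i + 1) = golden powi i + golden powi (i - 1)"
  using golden_powi_step[of "i - 1"] by (simp add: add.commute)

lemma golden_powi_less_iff [simp]: "golden powi i < golden powi j \<longleftrightarrow> i < j"
  using golden_gt_1 
  by (metis less_irrefl linorder_neqE_linordered_idom order_less_trans power_int_strict_increasing)

lemma golden_powi_le_iff [simp]: "golden powi i \<le> golden powi j \<longleftrightarrow> i \<le> j"
  by (meson golden_powi_less_iff linorder_not_le)

definition sparse :: "int set \<Rightarrow> bool" where
  "sparse A \<longleftrightarrow> (\<forall>i\<in>A. i + 1 \<notin> A)"

definition phi_sum :: "int set \<Rightarrow> real" where
  "phi_sum A = (\<Sum>i\<in>A. golden powi i)"

lemma sparse_subset: "sparse A \<Longrightarrow> B \<subseteq> A \<Longrightarrow> sparse B"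
  unfolding sparse_def by blast

lemma phi_sum_insert [simp]: "finite A \<Longrightarrow> i \<notin> A \<Longrightarrow> phi_sum (insert i A) = golden powi i + phi_sum A"
  by (simp add: phi_sum_def)

lemma phi_sum_empty [simp]: "phi_sum {} = 0"
  by (simp add: phi_sum_def)

lemma phi_sum_nonneg: "phi_sum A \<ge> 0"
  unfolding phi_sum_def by (intro sum_nonneg) (simp add: less_imp_le)

lemma phi_sum_remove: "finite A \<Longrightarrow> i \<in> A \<Longrightarrow> phi_sum A = golden powi i + phi_sum (A - {i})"
  unfolding phi_sum_def by (rule sum.remove)

text \<open>Below the top element \<open>b\<close> the next one is at most \<open>b - 2\<close>, so
  inductively the rest stays below \<open>golden powi (b - 1)\<close>, and with
  \<open>golden powi b\<close> the total stays below \<open>golden powi (b + 1)\<close>.\<close>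

lemma sparse_phi_sum_less:
  assumes "finite A" "sparse A" "A \<subseteq> {..<N}"
  shows "phi_sum A < golden powi N"
  using assms
proof (induction A arbitrary: N rule: finite_linorder_max_induct)
  case empty
  then show ?case by simp
next
  case (insert b A)
  have "A \<subseteq> {..<b - 1}"
  proof
    fix a assume a: "a \<in> A"
    with insert have "a < b" "a + 1 \<noteq> b" by (auto simp: sparse_def)
    then show "a \<in> {..<b - 1}" by simp
  qed
  with insert have "phi_sum A < golden powi (b - 1)"
    using sparse_subset by blast
  moreover have "b \<notin> A" using insert by blast
  ultimately have "phi_sum (insert b A) < golden powi b + golden powi (b - 1)"
    using insert by simp
  also have "\<dots> = golden powi (b + 1)"
    using golden_powi_Suc by simp
  also have "\<dots> \<le> golden powi N" using insert by simp
  finally show ?case .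
qed

section \<open>Existence of finite sparse representations\<close>

lemma int_set_has_max:
  fixes S :: "int set"
  assumes "x \<in> S" "\<And>y. y \<in> S \<Longrightarrow> y \<le> b"
  obtains M where "M \<in> S" "\<And>y. y \<in> S \<Longrightarrow> y \<le> M"
proof
  let ?T = "S \<inter> {x..b}"
  have fin: "finite ?T" by simp
  have ne: "x \<in> ?T" using assms by auto
  show "Max ?T \<in> S" using Max_in[OF fin] ne by blast
  fix y assume y: "y \<in> S"
  show "y \<le> Max ?T"
  proof (cases "y \<ge> x")
    case True
    then show ?thesis using y assms fin by (intro Max_ge) auto
  next
    case False
    moreover have "x \<le> Max ?T" using ne fin by (intro Max_ge)
    ultimately show ?thesis by linarith
  qed
qed

text \<open>Among all ways to write the number as a sum of at most as many powers, take one with the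
  largest possible top exponent; the rewriting steps \<open>\<phi>\<^sup>i + \<phi>\<^sup>i\<^sup>-\<^sup>1 = \<phi>\<^sup>i\<^sup>+\<^sup>1\<close> and
  \<open>2 \<phi>\<^sup>i = \<phi>\<^sup>i\<^sup>+\<^sup>1 + \<phi>\<^sup>i\<^sup>-\<^sup>2\<close> would raise it further.\<close>

lemma sum_of_powers_sparse:
  assumes "length xs \<le> c"
  shows "\<exists>A. finite A \<and> sparse A \<and> card A \<le> c \<and> phi_sum A = (\<Sum>i\<leftarrow>xs. golden powi i)"
  using assms
proof (induction c arbitrary: xs)
  case 0
  then show ?case by (intro exI[of _ "{}"]) (auto simp: sparse_def)
next
  case (Suc c)
  show ?case
  proof (cases xs)
    case Nil
    then show ?thesis by (intro exI[of _ "{}"]) (auto simp: sparse_def)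
  next
    case (Cons a as)
    define x where "x = (\<Sum>i\<leftarrow>xs. golden powi i)"
    define S where "S = {M. \<exists>ys. length ys \<le> c \<and> x = golden powi M + (\<Sum>i\<leftarrow>ys. golden powi i)}"
    have "a \<in> S" using Suc.prems Cons by (auto simp: S_def x_def)
    obtain m where m: "x < golden ^ m" using real_arch_pow[OF golden_gt_1] by blast
    have bound: "M \<le> int m" if "M \<in> S" for M
    proof -
      obtain ys where "x = golden powi M + (\<Sum>i\<leftarrow>ys. golden powi i)" using \<open>M \<in> S\<close> S_def by auto
      moreover have "(\<Sum>i\<leftarrow>ys. golden powi i) \<ge> 0"
        by (intro sum_list_nonneg) (auto simp: less_imp_le)
      ultimately have "golden powi M < golden powi (int m)" using m by simp
      then show ?thesis by (simp only: golden_powi_less_iff)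
    qed
    obtain M where M: "M \<in> S" "\<And>y. y \<in> S \<Longrightarrow> y \<le> M"
      using int_set_has_max[OF \<open>a \<in> S\<close> bound] by blast
    then obtain ys where ys: "length ys \<le> c" "x = golden powi M + (\<Sum>i\<leftarrow>ys. golden powi i)"
      by (auto simp: S_def)
    obtain B where B: "finite B" "sparse B" "card B \<le> c" "phi_sum B = (\<Sum>i\<leftarrow>ys. golden powi i)"
      using Suc.IH[OF ys(1)] by blast
    have list: "(\<Sum>i\<leftarrow>sorted_list_of_set C. golden powi i) = phi_sum C" if "finite C" for C
      using that by (simp add: phi_sum_def sum_list_distinct_conv_sum_set)
    have inS: "k \<in> S" if "x = golden powi k + ((\<Sum>i\<leftarrow>zs. golden powi i) + phi_sum C)"
      "finite C" "length zs + card C \<le> c" for k zs C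
      using that list[of C] by (auto simp: S_def intro!: exI[of _ "zs @ sorted_list_of_set C"])
    have x: "x = golden powi M + phi_sum B" using ys B by simp
    have cB: "Suc (card (B - {i})) \<le> c" if "i \<in> B" for i
      using that B by (metis card_Suc_Diff1)
    \<comment> \<open>An \<open>i > M\<close> could itself serve as the top exponent, while
      \<open>i = M\<close> and \<open>i = M - 1\<close> produce \<open>M + 1\<close> by the two
      rewriting steps; each contradicts the maximality of \<open>M\<close>.\<close>
    have "i < M - 1" if i: "i \<in> B" for i
    proof -
      have xi: "x = golden powi M + golden powi i + phi_sum (B - {i})"
        using x phi_sum_remove[OF B(1) i] by simp
      have "i \<in> S" using xi cB[OF i] B(1) by (intro inS[of i "[M]" "B - {i}"]) auto
      then have "i \<le> M" using M by blast
      moreover have "i \<noteq> M"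
      proof
        assume "i = M"
        then have "M + 1 \<in> S"
          using xi cB[OF i] B(1) golden_powi_Suc[of M] golden_powi_Suc[of "M - 1"]
          by (intro inS[of "M + 1" "[M - 2]" "B - {i}"]) auto
        then show False using M by fastforce
      qed
      moreover have "i \<noteq> M - 1"
      proof
        assume "i = M - 1"
        then have "M + 1 \<in> S"
          using xi cB[OF i] B(1) golden_powi_Suc[of M]
          by (intro inS[of "M + 1" "[]" "B - {i}"]) auto
        then show False using M by fastforce
      qed
      ultimately show ?thesis by linarith
    qed
    then have "M \<notin> B" "sparse (insert M B)"
      using B(2) by (fastforce simp: sparse_def)+
    then show ?thesis
      using B x unfolding x_def by (intro exI[of _ "insert M B"]) auto
  qed
qed

lemma nat_sparse_phi_sum:
  obtains A where "finite A" "sparse A" "phi_sum A = real n"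
proof -
  have "(\<Sum>i\<leftarrow>replicate n (0::int). golden powi i) = real n" by (simp add: sum_list_replicate)
  then show thesis using sum_of_powers_sparse[of "replicate n 0" n] that by auto
qed

section \<open>Uniqueness of digit expansions, including infinite ones\<close>

lemma has_sum_remove:
  fixes f :: "'a \<Rightarrow> real"
  assumes "(f has_sum s) A" "a \<in> A"
  shows "(f has_sum (s - f a)) (A - {a})"
  using assms by (intro has_sum_Diff has_sum_finiteI[of "{a}"]) auto

lemma has_sum_minus:
  fixes f g :: "'a \<Rightarrow> real"
  assumes "(f has_sum a) A" "(g has_sum b) A"
  shows "((\<lambda>x. f x - g x) has_sum (a - b)) A"
  using has_sum_add[OF assms(1), of "\<lambda>x. - g x" "- b"] assms(2) by (simp add: has_sum_uminus)

definition digit_term :: "(int \<Rightarrow> nat) \<Rightarrow> int \<Rightarrow> real" where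
  "digit_term e i = real (e i) * golden powi i"

text \<open>Finite partial sums are sparse and strictly below the bound, but strictness is lost in
  the limit: the tail \<open>1010...\<close> attains it.\<close>

lemma tail_sum_le:
  assumes e: "\<And>i. e i \<in> {0, 1}" "\<And>i. e i * e (i + 1) = 0"
    and s: "(digit_term e has_sum s) {..<N}"
  shows "s \<le> golden powi N"
proof (rule has_sum_le_finite_sums[OF s])
  fix F assume F: "finite F" "F \<subseteq> {..<N}"
  have eq: "sum (digit_term e) F = phi_sum {i \<in> F. e i = 1}"
    unfolding phi_sum_def digit_term_def
  proof (intro sum.mono_neutral_cong_right F(1) ballI)
    fix i assume "i \<in> F - {i \<in> F. e i = 1}"
    then have "e i = 0" using e(1)[of i] by auto
    then show "real (e i) * golden powi i = 0" by simp
  qed auto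
  have "sparse {i. e i = 1}"
    unfolding sparse_def
  proof safe
    fix i assume "e i = 1" "e (i + 1) = 1"
    then show False using e(2)[of i] by simp
  qed
  then have "phi_sum {i \<in> F. e i = 1} < golden powi N"
    using F by (intro sparse_phi_sum_less) (auto intro: sparse_subset)
  then show "sum (digit_term e) F \<le> golden powi N" using eq by simp
qed

text \<open>A digit \<open>0\<close> at \<open>N - 1\<close> would cap the sum at
  \<open>golden powi (N - 1)\<close>. The forced digits \<open>1\<close>, \<open>0\<close> leave an
  extremal tail two places lower, so the argument can be iterated.\<close>

lemma tail_sum_eq_imp_alternating:
  assumes e: "\<And>i. e i \<in> {0, 1}" "\<And>i. e i * e (i + 1) = 0"
    and s: "(digit_term e has_sum golden powi N) {..<N}"
  shows "e (N - 1) = 1 \<and> e (N - 2) = 0 \<and> (digit_term e has_sum golden powi (N - 2)) {..<N - 2}"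
proof -
  have s1: "(digit_term e has_sum (golden powi N - digit_term e (N - 1))) {..<N - 1}"
  proof -
    have "{..<N} - {N - 1} = {..<N - 1}" by auto
    then show ?thesis using has_sum_remove[OF s, of "N - 1"] by simp
  qed
  have "e (N - 1) \<noteq> 0"
  proof
    assume "e (N - 1) = 0"
    then have "golden powi N \<le> golden powi (N - 1)"
      using tail_sum_le[OF e s1] by (simp add: digit_term_def)
    then show False by simp
  qed
  then have one: "e (N - 1) = 1" using e(1)[of "N - 1"] by simp
  moreover have zero: "e (N - 2) = 0" using e(2)[of "N - 2"] one by simp
  moreover have "(digit_term e has_sum golden powi (N - 2)) {..<N - 2}"
  proof -
    have "{..<N - 1} - {N - 2} = {..<N - 2}" by auto
    moreover have "golden powi N - golden powi (N - 1) = golden powi (N - 2)"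
      using golden_powi_Suc[of "N - 1"] by simp
    ultimately show ?thesis
      using has_sum_remove[OF s1, of "N - 2"] one zero by (simp add: digit_term_def)
  qed
  ultimately show ?thesis by blast
qed

text \<open>Equality would iterate into the excluded tail starting at \<open>N - 1\<close>.\<close>

lemma tail_sum_less:
  assumes e: "\<And>i. e i \<in> {0, 1}" "\<And>i. e i * e (i + 1) = 0"
    and no_tail: "\<not> (\<exists>N. \<forall>k::nat. e (N - 2 * int k) = 1 \<and> e (N - 2 * int k - 1) = 0)"
    and s: "(digit_term e has_sum s) {..<N}"
  shows "s < golden powi N"
proof (rule ccontr)
  assume "\<not> s < golden powi N"
  then have "s = golden powi N" using tail_sum_le[OF e s] by simp
  then have s: "(digit_term e has_sum golden powi N) {..<N}" using s by simp
  have *: "(digit_term e has_sum golden powi (N - 2 * int k)) {..<N - 2 * int k}" for k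
  proof (induction k)
    case 0
    then show ?case using s by simp
  next
    case (Suc k)
    have "N - 2 * int k - 2 = N - 2 * int (Suc k)" by simp
    then show ?case using tail_sum_eq_imp_alternating[OF e Suc] by (simp only:)
  qed
  have "e (N - 1 - 2 * int k) = 1 \<and> e (N - 1 - 2 * int k - 1) = 0" for k
  proof -
    have "N - 1 - 2 * int k = N - 2 * int k - 1" "N - 1 - 2 * int k - 1 = N - 2 * int k - 2" by auto
    then show ?thesis using tail_sum_eq_imp_alternating[OF e *[of k]] by (simp only:)
  qed
  with no_tail show False by blast
qed

lemma is_phi_rep_has_sum_UNIV:
  assumes "is_phi_rep e x"
  shows "(digit_term e has_sum x) UNIV"
proof -
  obtain t where t: "\<forall>i>t. e i = 0" "((\<lambda>i. real (e i) * golden powi i) has_sum x) {..t}"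
    using assms unfolding is_phi_rep_def by blast
  show ?thesis
  proof -
    have "(digit_term e has_sum x) UNIV \<longleftrightarrow> (digit_term e has_sum x) {..t}"
      by (rule has_sum_cong_neutral) (auto simp: digit_term_def t(1))
    then show ?thesis using t(2) unfolding digit_term_def by simp
  qed
qed

text \<open>At the top place of disagreement the tail of \<open>e'\<close> would have to make up for
  \<open>golden powi N\<close>, which it cannot reach.\<close>

lemma is_phi_rep_agree_above:
  assumes e: "is_phi_rep e x" and e': "is_phi_rep e' x"
    and above: "\<And>i. i > N \<Longrightarrow> e i = e' i" and N: "e N = 1" "e' N = 0"
  shows False
proof -
  note h = is_phi_rep_has_sum_UNIV[OF e] and h' = is_phi_rep_has_sum_UNIV[OF e']
  obtain s where s: "(digit_term e has_sum s) {..<N}"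
    using summable_on_subset_banach[OF has_sum_imp_summable[OF h], of "{..<N}"]
    by (auto simp: summable_on_def)
  obtain s' where s': "(digit_term e' has_sum s') {..<N}"
    using summable_on_subset_banach[OF has_sum_imp_summable[OF h'], of "{..<N}"]
    by (auto simp: summable_on_def)
  let ?d = "\<lambda>i. digit_term e i - digit_term e' i"
  have "(?d has_sum (x - x)) UNIV" by (rule has_sum_minus[OF h h'])
  moreover have "(?d has_sum (x - x)) UNIV \<longleftrightarrow> (?d has_sum (x - x)) {..N}"
    by (rule has_sum_cong_neutral) (auto simp: digit_term_def above)
  ultimately have "(?d has_sum 0) {..N}" by simp
  then have "(?d has_sum (0 - ?d N)) ({..N} - {N})" by (rule has_sum_remove) simp
  moreover have "{..N} - {N} = {..<N}" by auto
  ultimately have "(?d has_sum (0 - ?d N)) {..<N}" by simp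
  from has_sum_unique[OF has_sum_minus[OF s s'] this] have "s - s' = - (golden powi N)"
    using N by (simp add: digit_term_def)
  moreover have "s \<ge> 0"
    using has_sum_nonneg[OF s] by (simp add: digit_term_def less_imp_le)
  moreover have "s' < golden powi N"
    using e' unfolding is_phi_rep_def by (intro tail_sum_less[OF _ _ _ s']) blast+
  ultimately show False by linarith
qed

lemma is_phi_rep_unique:
  assumes e: "is_phi_rep e x" and e': "is_phi_rep e' x"
  shows "e = e'"
proof (rule ccontr)
  assume "e \<noteq> e'"
  define S where "S = {i. e i \<noteq> e' i}"
  from \<open>e \<noteq> e'\<close> obtain a where a: "a \<in> S" by (auto simp: S_def)
  obtain t t' where "\<forall>i>t. e i = 0" "\<forall>i>t'. e' i = 0"
    using e e' unfolding is_phi_rep_def by blast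
  then have "i \<le> max t t'" if "i \<in> S" for i
    using that by (cases "i \<le> max t t'") (auto simp: S_def)
  then obtain M where M: "M \<in> S" "\<And>y. y \<in> S \<Longrightarrow> y \<le> M"
    using int_set_has_max[OF a] by blast
  then have above: "e i = e' i" if "i > M" for i
    using that M(2)[of i] unfolding S_def by force
  have "e M \<in> {0, 1}" "e' M \<in> {0, 1}" using e e' by (auto simp: is_phi_rep_def)
  then consider "e M = 1" "e' M = 0" | "e M = 0" "e' M = 1" using M(1) by (auto simp: S_def)
  then show False
  proof cases
    case 1
    then show False using is_phi_rep_agree_above[OF e e' above] by blast
  next
    case 2
    then show False using is_phi_rep_agree_above[OF e' e above[symmetric]] by blast
  qed
qed

lemma is_phi_rep_of_bool:
  assumes A: "finite A" "sparse A"
  shows "is_phi_rep (\<lambda>i. of_bool (i \<in> A)) (phi_sum A)"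
  unfolding is_phi_rep_def
proof (intro conjI notI)
  assume "\<exists>N. \<forall>k::nat. (of_bool (N - 2 * int k \<in> A) :: nat) = 1 \<and>
    (of_bool (N - 2 * int k - 1 \<in> A) :: nat) = 0"
  then obtain N where "range (\<lambda>k. N - 2 * int k) \<subseteq> A"
    by (auto split: if_splits simp: of_bool_def)
  moreover have "infinite (range (\<lambda>k. N - 2 * int k))"
    by (intro range_inj_infinite injI) simp
  ultimately show False using A(1) finite_subset by blast
next
  obtain t where t: "A \<subseteq> {..t}"
  proof (cases "A = {}")
    case False
    then show thesis using A(1) by (intro that[of "Max A"]) auto
  qed auto
  have "((\<lambda>i. real (of_bool (i \<in> A)) * golden powi i) has_sum phi_sum A) {..t}"
  proof -
    have "((\<lambda>i. golden powi i) has_sum phi_sum A) A \<longleftrightarrow>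
        ((\<lambda>i. real (of_bool (i \<in> A)) * golden powi i) has_sum phi_sum A) {..t}"
      by (rule has_sum_cong_neutral) (use t in auto)
    then show ?thesis using A(1) by (simp add: phi_sum_def)
  qed
  then show "\<exists>t. (\<forall>i>t. (of_bool (i \<in> A) :: nat) = 0) \<and>
      ((\<lambda>i. real (of_bool (i \<in> A)) * golden powi i) has_sum phi_sum A) {..t}"
    using t by (intro exI[of _ t]) auto
qed (use A(2) in \<open>auto simp: sparse_def\<close>)

text \<open>By uniqueness any finite sparse witness determines the exponents; this replaces the
  definite description from here on.\<close>

lemma phi_exponents_eqI:
  assumes "finite A" "sparse A" "phi_sum A = x"
  shows "phi_exponents x = A"
proof -
  have "phi_rep x = (\<lambda>i. of_bool (i \<in> A))"
    unfolding phi_rep_def using is_phi_rep_of_bool[OF assms(1,2)] assms(3) is_phi_rep_unique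
    by (intro the_equality) auto
  then show ?thesis by (auto simp: phi_exponents_def)
qed

section \<open>Odd-indexed Lucas numbers\<close>

lemma golden_mult_golden: "golden * golden = golden + 1" "golden * (golden * x) = golden * x + x"
  using golden_sq by (auto simp: power2_eq_square algebra_simps simp flip: mult.assoc)

text \<open>In lowest terms m / n the quadratic equation gives m^2 = m n + n^2, and parity forces
  both m and n to be even.\<close>

lemma golden_irrational: "golden \<notin> \<rat>"
proof
  assume "golden \<in> \<rat>"
  then obtain m n :: nat where mn: "n \<noteq> 0" "\<bar>golden\<bar> = m / n" "coprime m n"
    by (rule Rats_abs_nat_div_natE)
  then have "golden = m / n" using golden_gt_1 by simp
  then have m: "real m = golden * real n" using mn(1) by (simp add: field_simps)
  have "(real m)\<^sup>2 = real m * real n + (real n)\<^sup>2"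
    unfolding m power_mult_distrib golden_sq by (simp add: algebra_simps power2_eq_square)
  then have "real (m\<^sup>2) = real (m * n + n\<^sup>2)" by simp
  then have "m\<^sup>2 = m * n + n\<^sup>2" by (simp only: of_nat_eq_iff)
  then have "even (m\<^sup>2) = even (m * n + n\<^sup>2)" by simp
  then have "even m \<and> even n" by auto
  with mn(3) show False using coprime_common_divisor by fastforce
qed

text \<open>Both roots of t^2 = t + 1 have inverse t - 1, so multiplying by the root or its inverse
  changes the integer coordinates in the same way for both.\<close>

lemma golden_powi_conjugate:
  "\<exists>(a::int) (b::int). golden powi i = a + b * golden \<and> (1 - golden) powi i = a + b * (1 - golden)"
proof (induction i rule: int_induct[where k = 0])
  case base
  then show ?case by (intro exI[of _ 1] exI[of _ 0]) simp
next
  case (step1 i)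
  then obtain a b :: int where ab: "golden powi i = a + b * golden"
    "(1 - golden) powi i = a + b * (1 - golden)" by blast
  have "golden powi (i + 1) = golden powi i * golden"
    "(1 - golden) powi (i + 1) = (1 - golden) powi i * (1 - golden)"
    using golden_gt_1 by (simp_all add: power_int_add)
  then show ?case unfolding ab
    by (intro exI[of _ b] exI[of _ "a + b"]) (auto simp: algebra_simps golden_mult_golden)
next
  case (step2 i)
  then obtain a b :: int where ab: "golden powi i = a + b * golden"
    "(1 - golden) powi i = a + b * (1 - golden)" by blast
  have inv: "inverse golden = golden - 1" "inverse (1 - golden) = - golden"
    by (rule inverse_unique, simp add: algebra_simps golden_mult_golden)+
  have "golden powi (i - 1) = golden powi i * (golden - 1)"
    "(1 - golden) powi (i - 1) = (1 - golden) powi i * (- golden)"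
    using golden_gt_1 unfolding inv[symmetric] by (simp_all add: power_int_diff divide_inverse)
  then show ?case unfolding ab
    by (intro exI[of _ "b - a"] exI[of _ a]) (auto simp: algebra_simps golden_mult_golden)
qed

text \<open>Irrationality kills the coefficient of \<open>golden\<close>, so the value survives
  replacing \<open>golden\<close> by its conjugate.\<close>

lemma phi_sum_conjugate:
  assumes "phi_sum A = real n"
  shows "(\<Sum>i\<in>A. (1 - golden) powi i) = real n"
proof -
  obtain a b :: "int \<Rightarrow> int" where ab: "\<And>i. golden powi i = a i + b i * golden"
    "\<And>i. (1 - golden) powi i = a i + b i * (1 - golden)"
    using golden_powi_conjugate by metis
  have eq: "(\<Sum>i\<in>A. a i + b i * t) = real_of_int (sum a A) + real_of_int (sum b A) * t" for t :: real
    by (simp add: sum.distrib sum_distrib_right)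
  have n: "real n = real_of_int (sum a A) + real_of_int (sum b A) * golden"
    using assms unfolding phi_sum_def ab(1) eq by (rule sym)
  have "sum b A = 0"
  proof (rule ccontr)
    assume "sum b A \<noteq> 0"
    then have "golden = (real n - real_of_int (sum a A)) / real_of_int (sum b A)"
      using n by (simp add: field_simps del: of_int_sum)
    also have "\<dots> \<in> \<rat>" by (intro Rats_divide Rats_diff Rats_of_nat Rats_of_int)
    finally show False using golden_irrational by simp
  qed
  then show ?thesis using n unfolding ab(2) eq by simp
qed

text \<open>The sign comes from \<open>1 - golden = - inverse golden\<close>; here the parity of
  exponents enters.\<close>

lemma conjugate_powi: "(1 - golden) powi i = (if even i then 1 else -1) * golden powi (- i)"
proof -
  have "1 - golden = - inverse golden"
    using golden_sq golden_gt_1 by (simp add: field_simps power2_eq_square)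
  then show ?thesis by (auto simp: power_int_minus power_int_inverse power_int_minus_left)
qed

text \<open>Binet's formula; at an odd index the conjugate power is negative.\<close>

lemma lucas_odd: "real (lucas (2 * i + 1)) = golden powi (2 * int i + 1) - golden powi (- (2 * int i + 1))"
proof -
  have "real (lucas k) = golden powi (int k) + (1 - golden) powi (int k)" for k
  proof (induction k rule: lucas.induct)
    case (3 k)
    have "golden ^ Suc (Suc k) + (1 - golden) ^ Suc (Suc k) =
        (golden ^ Suc k + (1 - golden) ^ Suc k) + (golden ^ k + (1 - golden) ^ k)"
      by (simp add: algebra_simps golden_mult_golden)
    with 3 show ?case by (simp only: lucas.simps of_nat_add power_int_of_nat)
  qed auto
  from this[of "2 * i + 1"] show ?thesis
    by (simp add: conjugate_powi algebra_simps del: lucas.simps)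
qed

text \<open>The induction splits the trailing even power into the next odd and the next even
  one.\<close>

lemma one_minus_odd_powers:
  "golden powi (- (2 * int m)) + (\<Sum>i<m. golden powi (- (2 * int i + 1))) = 1"
proof (induction m)
  case (Suc m)
  have "golden powi (- (2 * int m)) = golden powi (- (2 * int m + 1)) + golden powi (- (2 * int (Suc m)))"
    using golden_powi_Suc[of "- (2 * int m + 1)"] by (simp add: algebra_simps)
  with Suc show ?case by simp
qed simp

section \<open>The two directions of the Lucas characterization\<close>

lemma sum_odd_inverse_powers_less_1:
  assumes "finite A"
  shows "(\<Sum>i\<in>A. golden powi (- (2 * int i + 1))) < 1"
proof -
  obtain m where "A \<subseteq> {..<m}" using assms finite_nat_iff_bounded by blast
  then have "(\<Sum>i\<in>A. golden powi (- (2 * int i + 1))) \<le> (\<Sum>i<m. golden powi (- (2 * int i + 1)))"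
    by (intro sum_mono2) (auto simp: less_imp_le)
  also have "\<dots> < 1" using one_minus_odd_powers[of m] golden_powi_pos[of "- (2 * int m)"] by linarith
  finally show ?thesis .
qed

lemma one_even_exponent_iff_sparse:
  assumes "finite A" "sparse A" "phi_sum A = real n"
  shows "n \<in> one_even_exponent \<longleftrightarrow> card {i \<in> A. even i} = 1"
  using phi_exponents_eqI[OF assms] by (simp add: one_even_exponent_def)

lemma zero_notin_one_even_exponent: "0 \<notin> one_even_exponent"
  using one_even_exponent_iff_sparse[of "{}" 0] by (simp add: sparse_def)

lemma lucas_sum_in_one_even_exponent:
  assumes "finite A" "n = 1 + (\<Sum>i\<in>A. lucas (2 * i + 1))"
  shows "n \<in> one_even_exponent"
proof (cases "A = {}")
  case True
  have "{i::int. i = 0 \<and> even i} = {0}" by auto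
  then show ?thesis using assms True one_even_exponent_iff_sparse[of "{0}" n]
    by (simp add: sparse_def)
next
  case False
  \<comment> \<open>One above the largest index: the exponent \<open>- (2 * m) + 1\<close> belongs
    to \<open>Max A\<close> and is cancelled, so \<open>- (2 * m)\<close> has no neighbour.\<close>
  define m where "m = Suc (Max A)"
  have Max: "Max A \<in> A" using assms(1) False by simp
  have Am: "A \<subseteq> {..<m}" using assms(1) by (auto simp: m_def less_Suc_eq_le)
  let ?p = "\<lambda>i. 2 * int i + 1" and ?q = "\<lambda>i. - (2 * int i + 1)"
  define P where "P = ?p ` A"
  \<comment> \<open>The negative odd powers in the expansion of 1 that no Lucas number
    cancels.\<close>
  define Q where "Q = ?q ` ({..<m} - A)"
  define B where "B = insert (- (2 * int m)) (P \<union> Q)"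
  have odd: "odd i" if "i \<in> P \<union> Q" for i using that by (auto simp: P_def Q_def)
  have fin: "finite P" "finite Q" using assms(1) by (auto simp: P_def Q_def)
  have "sparse B"
  proof -
    have "- (2 * int m) + 1 \<notin> P \<union> Q" "- (2 * int m) - 1 \<notin> P \<union> Q"
      using Max by (auto simp: P_def Q_def m_def)
    moreover have "i + 1 \<notin> P \<union> Q" if "i \<in> P \<union> Q" for i
      using odd[of i] odd[of "i + 1"] that by auto
    moreover have "i + 1 \<noteq> - (2 * int m)" if "i \<in> P \<union> Q" for i
      using that \<open>- (2 * int m) - 1 \<notin> P \<union> Q\<close> by (metis add_diff_cancel_right')
    ultimately show ?thesis unfolding sparse_def B_def by auto
  qed
  moreover have "finite B" using fin by (simp add: B_def)
  moreover have "phi_sum B = real n"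
  proof -
    have "- (2 * int m) \<notin> P \<union> Q" using odd by fastforce
    then have "phi_sum B = golden powi (- (2 * int m)) + phi_sum (P \<union> Q)"
      using fin by (simp add: B_def)
    also have "phi_sum (P \<union> Q) = phi_sum P + phi_sum Q"
      unfolding phi_sum_def using fin by (intro sum.union_disjoint) (auto simp: P_def Q_def)
    also have "phi_sum P = (\<Sum>i\<in>A. golden powi ?p i)"
      unfolding phi_sum_def P_def by (subst sum.reindex) (auto simp: inj_on_def)
    also have "phi_sum Q = (\<Sum>i\<in>{..<m} - A. golden powi ?q i)"
      unfolding phi_sum_def Q_def by (subst sum.reindex) (auto simp: inj_on_def)
    also have "\<dots> = (\<Sum>i<m. golden powi ?q i) - (\<Sum>i\<in>A. golden powi ?q i)"
      using Am by (intro sum_diff) auto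
    finally have "phi_sum B = 1 + (\<Sum>i\<in>A. golden powi ?p i - golden powi ?q i)"
      using one_minus_odd_powers[of m] by (simp add: sum_subtractf)
    also have "\<dots> = 1 + (\<Sum>i\<in>A. real (lucas (2 * i + 1)))"
      unfolding lucas_odd ..
    finally show ?thesis using assms(2) by (simp del: lucas.simps)
  qed
  moreover have "{i \<in> B. even i} = {- (2 * int m)}" using odd by (auto simp: B_def)
  ultimately show ?thesis using one_even_exponent_iff_sparse[of B n] by simp
qed

lemma one_even_exponent_imp_lucas_sum:
  assumes "n \<in> one_even_exponent"
  shows "\<exists>A. finite A \<and> n = 1 + (\<Sum>i\<in>A. lucas (2 * i + 1))"
proof -
  have "n \<ge> 1" using assms zero_notin_one_even_exponent by (cases n) auto
  obtain B where B: "finite B" "sparse B" "phi_sum B = real n" by (rule nat_sparse_phi_sum)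
  then have "card {i \<in> B. even i} = 1" using one_even_exponent_iff_sparse assms by blast
  then obtain k where k: "{i \<in> B. even i} = {k}" by (rule card_1_singletonE)
  then have kB: "k \<in> B" "even k" and oddB: "\<And>i. i \<in> B \<Longrightarrow> i \<noteq> k \<Longrightarrow> odd i" by auto
  have "golden powi 0 \<le> real n" using \<open>n \<ge> 1\<close> by simp
  \<comment> \<open>Odd exponents have negative conjugates, so only \<open>k\<close> contributes
    positively.\<close>
  also have n_le: "real n \<le> golden powi (- k)"
  proof -
    have "real n = (\<Sum>i\<in>B. (1 - golden) powi i)" using phi_sum_conjugate B by simp
    also have "\<dots> = golden powi (- k) + (\<Sum>i\<in>B - {k}. (1 - golden) powi i)"
      using kB B(1) by (simp add: sum.remove conjugate_powi)
    also have "(\<Sum>i\<in>B - {k}. (1 - golden) powi i) \<le> 0"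
      using oddB by (intro sum_nonpos) (auto simp: conjugate_powi less_imp_le)
    finally show ?thesis by simp
  qed
  finally have "k \<le> 0" unfolding golden_powi_le_iff by simp
  show ?thesis
  proof (cases "k = 0")
    case True
    then have "n = 1" using n_le \<open>n \<ge> 1\<close> by simp
    then show ?thesis by (intro exI[of _ "{}"]) simp
  next
    case False
    then have "k < 0" using \<open>k \<le> 0\<close> by simp
    let ?p = "\<lambda>i. 2 * int i + 1" and ?q = "\<lambda>i. - (2 * int i + 1)"
    define A where "A = {i. ?p i \<in> B}"
    define N where "N = B \<inter> {..<0}"
    have inj: "inj_on ?p A" by (auto simp: inj_on_def)
    have "?p ` A \<subseteq> B" by (auto simp: A_def)
    then have finA: "finite A" using B(1) inj finite_imageD finite_subset by blast
    have "B \<subseteq> ?p ` A \<union> N"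
    proof
      fix i assume i: "i \<in> B"
      show "i \<in> ?p ` A \<union> N"
      proof (cases "i < 0")
        case False
        then have "odd i" using oddB[OF i] \<open>k < 0\<close> by auto
        then have "i = ?p (nat (i div 2))" using False by (auto elim!: oddE)
        then have "i \<in> ?p ` A" using i unfolding A_def by (intro image_eqI[of _ _ "nat (i div 2)"]) auto
        then show ?thesis by blast
      qed (simp add: N_def i)
    qed
    then have BU: "B = ?p ` A \<union> N" using \<open>?p ` A \<subseteq> B\<close> by (auto simp: N_def)
    have "real n = phi_sum (?p ` A) + phi_sum N"
      unfolding B(3)[symmetric] phi_sum_def using B(1) finA
      by (subst BU, intro sum.union_disjoint) (auto simp: N_def)
    also have "phi_sum (?p ` A) = (\<Sum>i\<in>A. golden powi ?p i)"
      unfolding phi_sum_def by (subst sum.reindex[OF inj]) simp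
    also have "\<dots> = (\<Sum>i\<in>A. real (lucas (2 * i + 1))) + (\<Sum>i\<in>A. golden powi ?q i)"
      unfolding lucas_odd by (simp add: sum_subtractf)
    \<comment> \<open>The first sum on the right lies in [0, 1). The second lies strictly between 0
      and 1, since it contains \<open>k\<close> and is sparse with negative exponents only.\<close>
    finally have n: "real n - real (\<Sum>i\<in>A. lucas (2 * i + 1)) = (\<Sum>i\<in>A. golden powi ?q i) + phi_sum N"
      by (simp del: lucas.simps)
    have "k \<in> N" "finite N" using kB \<open>k < 0\<close> B(1) by (auto simp: N_def)
    then have "phi_sum N > 0" 
      using phi_sum_remove[of N k] phi_sum_nonneg[of "N - {k}"] golden_powi_pos[of k] by linarith
    moreover have "phi_sum N < golden powi 0"
      using B by (intro sparse_phi_sum_less) (auto simp: N_def intro: sparse_subset)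
    moreover have "(\<Sum>i\<in>A. golden powi ?q i) \<ge> 0"
      by (intro sum_nonneg) (simp add: less_imp_le)
    ultimately have "real n - real (\<Sum>i\<in>A. lucas (2 * i + 1)) > 0"
      "real n - real (\<Sum>i\<in>A. lucas (2 * i + 1)) < 2"
      unfolding n using sum_odd_inverse_powers_less_1[OF finA] by (simp_all del: lucas.simps)
    then have "n = 1 + (\<Sum>i\<in>A. lucas (2 * i + 1))" by linarith
    then show ?thesis using finA by blast
  qed
qed

section \<open>Zeckendorf representations\<close>

text \<open>The index shift by \<open>2\<close> gives the last digit the weight
  \<open>fib 2\<close>.\<close>

primrec zval :: "nat list \<Rightarrow> nat" where
  "zval [] = 0"
| "zval (c # w) = c * fib (length w + 2) + zval w"

text \<open>The first argument is the digit just before the word; \<open>0\<close> imposes nothing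
  on its start.\<close>

primrec no_adjacent_ones :: "nat \<Rightarrow> nat list \<Rightarrow> bool" where
  "no_adjacent_ones d [] \<longleftrightarrow> True"
| "no_adjacent_ones d (c # w) \<longleftrightarrow> \<not> (d = 1 \<and> c = 1) \<and> no_adjacent_ones c w"

lemma zval_eq_sum: "zval w = (\<Sum>j<length w. w ! j * fib (length w + 1 - j))"
proof (induction w)
  case (Cons c w)
  then show ?case by (simp add: sum.lessThan_Suc_shift del: sum.lessThan_Suc)
qed simp

lemma no_adjacent_ones_iff:
  "no_adjacent_ones d w \<longleftrightarrow> (w \<noteq> [] \<longrightarrow> \<not> (d = 1 \<and> hd w = 1)) \<and>
     (\<forall>j. Suc j < length w \<longrightarrow> \<not> (w ! j = 1 \<and> w ! Suc j = 1))"
proof (induction w arbitrary: d)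
  case (Cons c w)
  have "(\<forall>j. Suc j < length (c # w) \<longrightarrow> \<not> ((c # w) ! j = 1 \<and> (c # w) ! Suc j = 1)) \<longleftrightarrow>
    (w \<noteq> [] \<longrightarrow> \<not> (c = 1 \<and> hd w = 1)) \<and>
    (\<forall>j. Suc j < length w \<longrightarrow> \<not> (w ! j = 1 \<and> w ! Suc j = 1))" (is "?L \<longleftrightarrow> ?R")
  proof
    assume L: ?L
    from spec[OF L, of 0] have "w \<noteq> [] \<longrightarrow> \<not> (c = 1 \<and> hd w = 1)" by (auto simp: hd_conv_nth)
    moreover have "\<not> (w ! j = 1 \<and> w ! Suc j = 1)" if "Suc j < length w" for j
      using spec[OF L, of "Suc j"] that by simp
    ultimately show ?R by blast
  next
    assume ?R
    then show ?L by (auto simp: nth_Cons hd_conv_nth split: nat.splits)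
  qed
  then show ?case unfolding no_adjacent_ones.simps Cons.IH by simp
qed simp

lemma is_zeckendorf_iff:
  "is_zeckendorf w n \<longleftrightarrow> set w \<subseteq> {0, 1} \<and> (w \<noteq> [] \<longrightarrow> hd w \<noteq> 0) \<and> no_adjacent_ones 0 w \<and> n = zval w"
  unfolding is_zeckendorf_def zval_eq_sum no_adjacent_ones_iff by auto

text \<open>A preceding \<open>1\<close> forces the next digit to be \<open>0\<close>, which lowers
  the bound by one Fibonacci index.\<close>

lemma zval_less:
  assumes "set w \<subseteq> {0, 1}" "no_adjacent_ones d w" "d \<in> {0, 1}"
  shows "zval w < (if d = 0 then fib (length w + 2) else fib (length w + 1))"
  using assms
proof (induction w arbitrary: d)
  case (Cons c w)
  then have IH: "zval w < (if c = 0 then fib (length w + 2) else fib (length w + 1))" by auto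
  show ?case using IH Cons.prems by auto
qed auto

text \<open>The leading digits agree because the remaining digits are worth less than the weight of
  a leading \<open>1\<close>.\<close>

lemma zval_inj:
  assumes "length w = length w'" "zval w = zval w'" "set w \<subseteq> {0, 1}" "set w' \<subseteq> {0, 1}"
    "no_adjacent_ones d w" "no_adjacent_ones d' w'"
  shows "w = w'"
  using assms
proof (induction w w' arbitrary: d d' rule: list_induct2)
  case (Cons c w c' w')
  have less: "zval w < fib (length w + 2)" "zval w' < fib (length w + 2)"
    using zval_less[of w c] zval_less[of w' c'] Cons fib_Suc_mono[of "length w + 1"]
    by (auto split: if_splits)
  have "c \<in> {0, 1}" "c' \<in> {0, 1}" using Cons.prems by auto
  then have "c = c'" using Cons.prems(1) Cons.hyps less by auto
  then show ?case using Cons by auto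
qed simp

text \<open>A nonempty \<open>w\<close> has its value in the interval from
  \<open>fib (length w + 1)\<close> up to, but excluding, \<open>fib (length w + 2)\<close>, so the
  value fixes the length.\<close>

lemma is_zeckendorf_unique:
  assumes "is_zeckendorf w n" "is_zeckendorf w' n"
  shows "w = w'"
proof -
  have bounds: "zval u < fib (length u + 2)" "u \<noteq> [] \<Longrightarrow> fib (length u + 1) \<le> zval u"
    if "is_zeckendorf u n" for u
    using that zval_less[of u 0] by (auto simp: is_zeckendorf_iff neq_Nil_conv)
  have "\<not> length u < length u'" if "is_zeckendorf u n" "is_zeckendorf u' n" for u u'
  proof
    assume "length u < length u'"
    then have "fib (length u + 2) \<le> fib (length u' + 1)" by (intro fib_mono) simp
    moreover have "u' \<noteq> []" using \<open>length u < length u'\<close> by auto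
    ultimately show False using bounds[OF that(1)] bounds[OF that(2)] that
      by (auto simp: is_zeckendorf_iff)
  qed
  from this[OF assms] this[OF assms(2,1)] have "length w = length w'" by simp
  then show ?thesis using assms unfolding is_zeckendorf_iff by (intro zval_inj[of w w' 0 0]) simp_all
qed

text \<open>Greedy choice at a fixed length, leading zeros allowed; after a \<open>1\<close> the
  remainder is small enough for a \<open>0\<close> to follow.\<close>

lemma zval_surj:
  assumes "n < fib (R + 2)"
  shows "\<exists>w. set w \<subseteq> {0, 1} \<and> length w = R \<and> no_adjacent_ones 0 w \<and> zval w = n"
  using assms
proof (induction R arbitrary: n rule: less_induct)
  case (less R)
  show ?case
  proof (cases R)
    case 0
    then show ?thesis using less.prems by (intro exI[of _ "[]"]) auto
  next
    case (Suc S)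
    show ?thesis
    proof (cases "n < fib (S + 2)")
      case True
      then obtain w where "set w \<subseteq> {0, 1} \<and> length w = S \<and> no_adjacent_ones 0 w \<and> zval w = n"
        using less.IH[of S n] Suc by auto
      then show ?thesis using Suc by (intro exI[of _ "0 # w"]) auto
    next
      case False
      show ?thesis
      proof (cases S)
        case 0
        then show ?thesis using False less.prems Suc
          by (intro exI[of _ "[1]"]) (auto simp: eval_nat_numeral)
      next
        case (Suc U)
        have "n - fib (S + 2) < fib (U + 2)"
          using False less.prems \<open>R = Suc S\<close> Suc by auto
        then obtain w where w: "set w \<subseteq> {0, 1}" "length w = U" "no_adjacent_ones 0 w"
          "zval w = n - fib (S + 2)"
          using less.IH[of U] Suc \<open>R = Suc S\<close> by auto
        then show ?thesis using False Suc \<open>R = Suc S\<close> by (intro exI[of _ "1 # 0 # w"]) auto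
      qed
    qed
  qed
qed

lemma strip_leading_zeros:
  assumes "set w \<subseteq> {0, 1}" "no_adjacent_ones 0 w"
  shows "\<exists>w'. is_zeckendorf w' (zval w)"
  using assms
proof (induction w)
  case (Cons c w)
  show ?case
  proof (cases "c = 0")
    case True
    then show ?thesis using Cons by simp
  next
    case False
    then show ?thesis using Cons.prems by (intro exI[of _ "c # w"]) (simp add: is_zeckendorf_iff)
  qed
qed (auto simp: is_zeckendorf_iff intro!: exI[of _ "[]"])

lemma less_fib_add_2: "n < fib (n + 2)"
proof (induction n)
  case (Suc n)
  have "fib (Suc n) > 0" by (rule fib_neq_0_nat) simp
  then show ?case using Suc by simp
qed simp

lemma is_zeckendorf_zeckendorf: "is_zeckendorf (zeckendorf n) n"
proof -
  obtain w where "is_zeckendorf w n"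
    using zval_surj[OF less_fib_add_2] strip_leading_zeros by metis
  then show ?thesis
    unfolding zeckendorf_def by (rule theI) (use is_zeckendorf_unique \<open>is_zeckendorf w n\<close> in blast)
qed

lemma zeckendorf_eq_iff: "zeckendorf n = w \<longleftrightarrow> is_zeckendorf w n"
  using is_zeckendorf_zeckendorf is_zeckendorf_unique by blast

section \<open>The automaton\<close>

text \<open>Decides whether \<open>x\<close> is one plus a sum of distinct odd-indexed Lucas numbers
  of index at most \<open>R\<close>. Integer arguments allow for negative remainders.\<close>

primrec lucas_reach :: "nat \<Rightarrow> int \<Rightarrow> bool" where
  "lucas_reach 0 x \<longleftrightarrow> x = 1"
| "lucas_reach (Suc R) x \<longleftrightarrow>
     lucas_reach R x \<or> even R \<and> lucas_reach R (x - int (lucas (Suc R)))"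

lemma lucas_Suc_fib: "lucas (Suc R) = fib (Suc R) + 2 * fib R"
  by (induction R rule: fib.induct) auto

text \<open>The upper bounds are L_R - 1 for even \<open>R\<close> and L_(R+1) - 1 for odd
  \<open>R\<close>, attained by taking all available Lucas numbers and written in the automaton's
  coordinates \<open>fib (Suc R)\<close> and \<open>fib R\<close>.\<close>

lemma lucas_reach_bounds:
  assumes "lucas_reach R x"
  shows "1 \<le> x \<and> x \<le> (if even R then 2 * int (fib (Suc R)) - int (fib R) - 1
     else int (fib (Suc R)) + 2 * int (fib R) - 1)"
  using assms
proof (induction R arbitrary: x)
  case (Suc R)
  from Suc.prems consider "lucas_reach R x" | "even R" "lucas_reach R (x - int (lucas (Suc R)))"
    by auto
  then show ?case
  proof cases
    case 1
    from Suc.IH[OF this] show ?thesis by auto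
  next
    case 2
    from Suc.IH[OF this(2)] show ?thesis using 2(1) unfolding lucas_Suc_fib by auto
  qed
qed simp

lemma lucas_reach_iff_sum:
  "lucas_reach R x \<longleftrightarrow>
     (\<exists>A. (\<forall>i\<in>A. 2 * i + 1 \<le> R) \<and> x = 1 + int (\<Sum>i\<in>A. lucas (2 * i + 1)))"
proof (induction R arbitrary: x)
  case 0
  show ?case by auto
next
  case (Suc R)
  let ?P = "\<lambda>R x A. (\<forall>i\<in>A. 2 * i + 1 \<le> R) \<and> x = 1 + int (\<Sum>i\<in>A. lucas (2 * i + 1))"
  have fin: "finite A" if "?P R x A" for R x A
    using that by (intro finite_subset[of A "{..R}"]) auto
  show ?case
  proof
    assume "lucas_reach (Suc R) x"
    then consider "lucas_reach R x" | "even R" "lucas_reach R (x - int (lucas (Suc R)))" by auto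
    then show "\<exists>A. ?P (Suc R) x A"
    proof cases
      case 1
      then show ?thesis unfolding Suc.IH using le_SucI by blast
    next
      case 2
      then obtain A where A: "?P R (x - int (lucas (Suc R))) A" unfolding Suc.IH by blast
      obtain k where k: "R = 2 * k" using 2(1) by blast
      have "k \<notin> A" using A k by force
      then have "(\<Sum>i\<in>insert k A. lucas (2 * i + 1)) = lucas (Suc R) + (\<Sum>i\<in>A. lucas (2 * i + 1))"
        using fin[OF A] k by (simp del: lucas.simps)
      moreover have "\<forall>i\<in>insert k A. 2 * i + 1 \<le> Suc R" using A k by auto
      ultimately have "?P (Suc R) x (insert k A)" using A by simp
      then show ?thesis by blast
    qed
  next
    assume "\<exists>A. ?P (Suc R) x A"
    then obtain A where A: "?P (Suc R) x A" by blast
    show "lucas_reach (Suc R) x"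
    proof (cases "\<exists>k\<in>A. R = 2 * k")
      case True
      then obtain k where k: "k \<in> A" "R = 2 * k" by blast
      have "(\<Sum>i\<in>A. lucas (2 * i + 1)) = lucas (Suc R) + (\<Sum>i\<in>A - {k}. lucas (2 * i + 1))"
        using fin[OF A] k by (subst sum.remove[of A k]) (simp_all del: lucas.simps)
      moreover have "\<forall>i\<in>A - {k}. 2 * i + 1 \<le> R"
      proof
        fix i assume "i \<in> A - {k}"
        then have "2 * i + 1 \<le> Suc R" "i \<noteq> k" using A by auto
        then show "2 * i + 1 \<le> R" using k by linarith
      qed
      ultimately have "?P R (x - int (lucas (Suc R))) (A - {k})" using A by simp
      then have "lucas_reach R (x - int (lucas (Suc R)))" unfolding Suc.IH by blast
      then show ?thesis using k by simp
    next
      case False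
      have "\<forall>i\<in>A. 2 * i + 1 \<le> R"
      proof
        fix i assume "i \<in> A"
        then have "2 * i + 1 \<le> Suc R" "R \<noteq> 2 * i" using A False by auto
        then show "2 * i + 1 \<le> R" by linarith
      qed
      then have "?P R x A" using A by blast
      then have "lucas_reach R x" unfolding Suc.IH by blast
      then show ?thesis by simp
    qed
  qed
qed

text \<open>As L_(S+1) = F_(S+2) + F_S, using it for any \<open>S \<ge> R\<close> would overshoot
  \<open>fib (R + 2)\<close>.\<close>

lemma lucas_reach_restrict:
  assumes "R \<le> S" "lucas_reach S x" "x < int (fib (R + 2))"
  shows "lucas_reach R x"
  using assms
proof (induction S rule: dec_induct)
  case (step S)
  have "fib (R + 2) \<le> fib (S + 2)" using step by (intro fib_mono) auto
  then have "\<not> lucas_reach S (x - int (lucas (Suc S)))"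
    using step.prems lucas_reach_bounds[of S "x - int (lucas (Suc S))"] unfolding lucas_Suc_fib by auto
  then show ?case using step by auto
qed

text \<open>Words of length \<open>R\<close> without adjacent ones have values below this bound, so
  for them only Lucas indices up to \<open>R\<close> matter.\<close>

lemma one_even_exponent_iff_lucas_reach:
  assumes "n < fib (R + 2)"
  shows "n \<in> one_even_exponent \<longleftrightarrow> lucas_reach R (int n)"
proof
  assume "n \<in> one_even_exponent"
  then obtain A where A: "finite A" "n = 1 + (\<Sum>i\<in>A. lucas (2 * i + 1))"
    using one_even_exponent_imp_lucas_sum by blast
  obtain S where S: "\<forall>i\<in>A. i < S" using finite_nat_set_iff_bounded A(1) by blast
  have "\<forall>i\<in>A. 2 * i + 1 \<le> max R (2 * S)" using S by fastforce
  moreover have "int n = 1 + int (\<Sum>i\<in>A. lucas (2 * i + 1))" using A(2) by simp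
  ultimately have "lucas_reach (max R (2 * S)) (int n)"
    unfolding lucas_reach_iff_sum by blast
  then show "lucas_reach R (int n)"
    by (rule lucas_reach_restrict[rotated]) (use assms in auto)
next
  assume "lucas_reach R (int n)"
  then obtain A where A: "\<forall>i\<in>A. 2 * i + 1 \<le> R" "int n = 1 + int (\<Sum>i\<in>A. lucas (2 * i + 1))"
    unfolding lucas_reach_iff_sum by blast
  have "finite A" using A(1) by (intro finite_subset[of A "{..R}"]) auto
  moreover have "n = 1 + (\<Sum>i\<in>A. lucas (2 * i + 1))" using A(2) by linarith
  ultimately show "n \<in> one_even_exponent" by (rule lucas_sum_in_one_even_exponent)
qed

text \<open>The states are the ones reached in the subset construction: for either parity of the number
  \<open>R\<close> of remaining digits, a state records the pairs \<open>(a, b)\<close> such that the suffix value \<open>v\<close> is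
  acceptable iff some \<open>v + a F\<^sub>R\<^sub>+\<^sub>1 + b F\<^sub>R\<close> is one plus a sum of distinct \<open>L\<^sub>2\<^sub>i\<^sub>+\<^sub>1\<close> with
  \<open>2 i + 1 \<le> R\<close>. Pairs whose value is out of range for all \<open>R\<close> have been dropped. State \<open>17\<close> is dead,
  and state \<open>18\<close> is a copy of state \<open>0\<close> that rejects leading zeros.\<close>

definition prev_digit :: "nat \<Rightarrow> nat" where
  "prev_digit q = [0, 1, 0, 0, 1, 0, 1, 0, 0, 1, 0, 1, 0, 0, 1, 0, 1, 0] ! q"

definition even_offsets :: "nat \<Rightarrow> (int \<times> int) list" where
  "even_offsets q =
     [[(0, 0)], [(0, -1), (1, 1)], [(1, -1)], [], [(0, 0)], [(0, -2), (1, 0)], [(1, -1)], [], [],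
      [], [(0, 0)], [(0, -1), (1, 1)], [(1, -1)], [(0, -1)], [], [], [], []] ! q"

definition odd_offsets :: "nat \<Rightarrow> (int \<times> int) list" where
  "odd_offsets q =
     [[(0, 0)], [(1, 1)], [(-1, 0)], [(0, 1)], [], [], [], [(0, 0)], [(1, 1)],
      [(-1, 1)], [], [], [], [], [(1, 1)], [(-1, 0)], [(0, 1)], []] ! q"

definition delta :: "nat \<Rightarrow> nat \<Rightarrow> nat" where
  "delta q c =
     (if c = 0 then [0, 2, 3, 5, 7, 8, 3, 10, 12, 13, 7, 15, 3, 15, 12, 17, 5, 17, 17]
      else [1, 17, 4, 6, 17, 9, 17, 11, 17, 17, 14, 17, 17, 16, 17, 4, 17, 17, 1]) ! q"

section \<open>Correctness of the transition table\<close>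

definition suffix_ok :: "nat \<Rightarrow> nat list \<Rightarrow> bool" where
  "suffix_ok q w \<longleftrightarrow> no_adjacent_ones (prev_digit q) w \<and>
     (\<exists>(a, b) \<in> set (if even (length w) then even_offsets q else odd_offsets q).
        lucas_reach (length w)
          (int (zval w) + a * int (fib (Suc (length w))) + b * int (fib (length w))))"

lemma less_18_cases:
  assumes "q < (18::nat)"
  shows "q = 0 \<or> q = 1 \<or> q = 2 \<or> q = 3 \<or> q = 4 \<or> q = 5 \<or> q = 6 \<or> q = 7 \<or> q = 8 \<or> q = 9 \<or>
    q = 10 \<or> q = 11 \<or> q = 12 \<or> q = 13 \<or> q = 14 \<or> q = 15 \<or> q = 16 \<or> q = 17"
  using assms by presburger

lemma fib_Suc_le: "R > 0 \<Longrightarrow> fib (Suc R) \<le> 2 * fib R"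
  using fib_Suc_mono[of "R - 1"] by (cases R) auto

text \<open>With \<open>R\<close> digits left after \<open>c\<close>, reading \<open>c\<close> sends
  a pair (a, b) to (a + b + c, a + c); guessing L_(R+1), possible only for even \<open>R\<close>,
  further subtracts (1, 2).\<close>

lemma suffix_ok_step:
  assumes q: "q < 18" and c: "c \<in> {0, 1}" and w: "set w \<subseteq> {0, 1}"
  shows "suffix_ok q (c # w) \<longleftrightarrow> suffix_ok (delta q c) w"
proof -
  define R where "R = length w"
  define g h v where "g = int (fib (Suc R))" and "h = int (fib R)" and "v = int (zval w)"
  have gh: "0 \<le> h" "h \<le> g" "1 \<le> g" "R > 0 \<longrightarrow> 1 \<le> h \<and> g \<le> 2 * h" "R = 0 \<longrightarrow> h = 0 \<and> g = 1"
    using fib_Suc_mono[of R] fib_neq_0_nat[of "Suc R"] fib_neq_0_nat[of R] fib_Suc_le[of R]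
    by (auto simp: g_def h_def)
  have v: "0 \<le> v" "no_adjacent_ones 0 w \<Longrightarrow> v < g + h" "no_adjacent_ones (Suc 0) w \<Longrightarrow> v < g"
    using zval_less[OF w, of 0] zval_less[OF w, of 1] by (auto simp: v_def g_def h_def R_def)
  have L: "int (lucas (Suc R)) = g + 2 * h" by (simp add: lucas_Suc_fib g_def h_def)
  show ?thesis
  proof (cases "even R")
    case True
    have bd: "\<And>x. lucas_reach R x \<Longrightarrow> 1 \<le> x \<and> x \<le> 2 * g - h - 1"
      using lucas_reach_bounds[of R] True by (auto simp: g_def h_def)
    have step: "lucas_reach (Suc R) x \<longleftrightarrow> lucas_reach R x \<or> lucas_reach R (x - (g + 2 * h))" for x
      using True L by simp
    have lhs: "suffix_ok q (c # w) \<longleftrightarrow> no_adjacent_ones (prev_digit q) (c # w) \<and>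
      (\<exists>(a, b) \<in> set (odd_offsets q). lucas_reach R (int c * (g + h) + v + a * (g + h) + b * g) \<or> 
         lucas_reach R (int c * (g + h) + v + a * (g + h) + b * g - (g + 2 * h)))"
      unfolding suffix_ok_def using True step
      by (simp add: R_def[symmetric] g_def h_def v_def del: lucas_reach.simps)
    have rhs: "suffix_ok (delta q c) w \<longleftrightarrow> no_adjacent_ones (prev_digit (delta q c)) w \<and>
      (\<exists>(a, b) \<in> set (even_offsets (delta q c)). lucas_reach R (v + a * g + b * h))"
      unfolding suffix_ok_def using True
      by (simp add: R_def[symmetric] g_def h_def v_def del: lucas_reach.simps)
    \<comment> \<open>Unless adjacency already fails, each new pair is in the list of the successor
      state or has a value excluded by \<open>bd\<close> and the bounds on \<open>v\<close>.\<close>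
    show ?thesis unfolding lhs rhs
      using c less_18_cases[OF q]
      by (elim insertE disjE emptyE;
          simp add: odd_offsets_def even_offsets_def delta_def prev_digit_def;
          use v gh bd in \<open>smt (verit)\<close>)
  next
    case False
    have bd: "\<And>x. lucas_reach R x \<Longrightarrow> 1 \<le> x \<and> x \<le> g + 2 * h - 1"
      using lucas_reach_bounds[of R] False by (auto simp: g_def h_def)
    have step: "lucas_reach (Suc R) x \<longleftrightarrow> lucas_reach R x" for x
      using False by simp
    have lhs: "suffix_ok q (c # w) \<longleftrightarrow> no_adjacent_ones (prev_digit q) (c # w) \<and>
      (\<exists>(a, b) \<in> set (even_offsets q). lucas_reach R (int c * (g + h) + v + a * (g + h) + b * g))"
      unfolding suffix_ok_def using False step
      by (simp add: R_def[symmetric] g_def h_def v_def del: lucas_reach.simps)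
    have rhs: "suffix_ok (delta q c) w \<longleftrightarrow> no_adjacent_ones (prev_digit (delta q c)) w \<and>
      (\<exists>(a, b) \<in> set (odd_offsets (delta q c)). lucas_reach R (v + a * g + b * h))"
      unfolding suffix_ok_def using False
      by (simp add: R_def[symmetric] g_def h_def v_def del: lucas_reach.simps)
    have "R > 0" using False by (cases R) auto
    show ?thesis unfolding lhs rhs
      using c less_18_cases[OF q]
      by (elim insertE disjE emptyE;
          simp add: odd_offsets_def even_offsets_def delta_def prev_digit_def;
          use v gh bd \<open>R > 0\<close> in \<open>smt (verit)\<close>)
  qed
qed

text \<open>With no digit left a pair (a, b) has value a, which must be 1; these are the states
  having an even offset with a = 1.\<close>

definition accepting :: "nat set" where
  "accepting = {1, 2, 5, 6, 11, 12}"

lemma delta_less: "q < 19 \<Longrightarrow> c \<in> {0, 1} \<Longrightarrow> delta q c < 18"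
  using less_18_cases[of q] by (cases "q = 18") (auto simp: delta_def)

lemma foldl_delta_accepting:
  assumes "q < 18" "set w \<subseteq> {0, 1}"
  shows "foldl delta q w \<in> accepting \<longleftrightarrow> suffix_ok q w"
  using assms
proof (induction w arbitrary: q)
  case Nil
  from less_18_cases[OF Nil(1)] show ?case
    by (elim disjE) (simp_all add: accepting_def suffix_ok_def even_offsets_def)
next
  case (Cons c w)
  then show ?case using suffix_ok_step[of q c w] delta_less[of q c] by simp
qed

lemma foldl_delta_zeckendorf:
  assumes w: "set w \<subseteq> {0, 1}"
  shows "foldl delta 18 w \<in> accepting \<longleftrightarrow> w \<in> zeckendorf ` one_even_exponent"
proof -
  have "w \<in> zeckendorf ` one_even_exponent \<longleftrightarrow> (\<exists>n\<in>one_even_exponent. is_zeckendorf w n)"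
    unfolding zeckendorf_eq_iff[symmetric] by auto
  also have "\<dots> \<longleftrightarrow> is_zeckendorf w (zval w) \<and> zval w \<in> one_even_exponent"
    by (auto simp: is_zeckendorf_iff)
  also have "\<dots> \<longleftrightarrow> foldl delta 18 w \<in> accepting"
  proof (cases w)
    \<comment> \<open>The empty word represents 0, which has no even exponent, and \<open>18\<close>
      is not accepting.\<close>
    case Nil
    then show ?thesis using zero_notin_one_even_exponent by (simp add: accepting_def)
  next
    case (Cons c u)
    then consider "c = 0" | "c = 1" using w by auto
    then show ?thesis
    proof cases
      case 1
      have "delta 18 c = 17" using 1 by (simp add: delta_def)
      then have "foldl delta 18 w \<in> accepting \<longleftrightarrow> suffix_ok 17 u"
        using foldl_delta_accepting[of 17 u] w Cons by simp
      moreover have "\<not> suffix_ok 17 u"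
        by (simp add: suffix_ok_def even_offsets_def odd_offsets_def)
      ultimately show ?thesis using 1 Cons by (simp add: is_zeckendorf_iff)
    next
      case 2
      have "delta 18 c = delta 0 c" using 2 by (simp add: delta_def)
      then have "foldl delta 18 w \<in> accepting \<longleftrightarrow> suffix_ok 0 w"
        using foldl_delta_accepting[of 0 w] w Cons by simp
      \<comment> \<open>State \<open>0\<close> has the single offset (0, 0) for both parities, so
        the value itself is tested.\<close>
      also have "\<dots> \<longleftrightarrow> no_adjacent_ones 0 w \<and> lucas_reach (length w) (int (zval w))"
        by (simp add: suffix_ok_def even_offsets_def odd_offsets_def prev_digit_def)
      also have "\<dots> \<longleftrightarrow> is_zeckendorf w (zval w) \<and> zval w \<in> one_even_exponent"
        using one_even_exponent_iff_lucas_reach[of "zval w" "length w"] zval_less[OF w, of 0] w Cons 2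
        by (auto simp: is_zeckendorf_iff)
      finally show ?thesis by simp
    qed
  qed
  finally show ?thesis by simp
qed

theorem theorem7:
  shows "regular_language {0, 1} (zeckendorf ` one_even_exponent) \<and>
    (\<forall>n\<ge>1. n \<in> one_even_exponent \<longleftrightarrow>
      (\<exists>A :: nat set. finite A \<and> n - 1 = (\<Sum>i\<in>A. lucas (2 * i + 1))))"
proof (intro conjI allI impI)
  let ?M = "\<lparr>states = {..<19}, init = 18, final = accepting, nxt = delta\<rparr> :: (nat, nat) dfa"
  have "is_dfa {0, 1} ?M"
    using delta_less by (fastforce simp: is_dfa_def accepting_def)
  moreover have "dfa_language {0, 1} ?M = zeckendorf ` one_even_exponent"
  proof -
    have "set (zeckendorf n) \<subseteq> {0, 1}" for n
      using is_zeckendorf_zeckendorf by (auto simp: is_zeckendorf_iff)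
    then show ?thesis
      using foldl_delta_zeckendorf by (auto simp: dfa_language_def lists_eq_set)
  qed
  ultimately show "regular_language {0, 1} (zeckendorf ` one_even_exponent)"
    unfolding regular_language_def by blast
next
  fix n :: nat assume "n \<ge> 1"
  \<comment> \<open>\<open>n \<ge> 1\<close> keeps the subtraction from truncating.\<close>
  then have "n - 1 = s \<longleftrightarrow> n = 1 + s" for s by auto
  then show "n \<in> one_even_exponent \<longleftrightarrow>
      (\<exists>A :: nat set. finite A \<and> n - 1 = (\<Sum>i\<in>A. lucas (2 * i + 1)))"
    using one_even_exponent_imp_lucas_sum lucas_sum_in_one_even_exponent by blast
qed

end
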